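(* Let $\Sigma\cup\{\phi\}$ be a finite set of conditional independence and inclusion atoms, and let $G_{\Sigma,\phi}=(V_{\Sigma,\phi},E_{\Sigma,\phi})$ be the graph defined below. (1) If $\phi$ is $a_1\ldots a_k\subseteq b_1\ldots b_k$, then $\Sigma\models\phi$ if and only if there is $w\in V_{\Sigma,\phi}$ such that $v\sim_{a_ib_i}w$ for all $1\le i\le k$ (where $v$ is the initial vertex). (2) If $\phi$ is $\vec b\perp_{\vec a}\vec c$, then $\Sigma\models\phi$ if and only if there is $v\in V_{\Sigma,\phi}$ such that $v^+\sim_{bb}v$ for all $b\in\vec a\vec b$ and $v^-\sim_{cc}v$ for all $c\in\vec a\vec c$.
   Context: Teams: a team $X$ is a set of assignments (maps from a common finite set of variables $\mathrm{Dom}(X)$ into the domain of a model). Atoms: $X$ satisfies $\vec y\perp_{\vec x}\vec z$ (conditional independence; tuples not necessarily disjoint) iff for all $s,s'\in X$ with $s(\vec x)=s'(\vec x)$ there is $s''\in X$ with $s''(\vec x)=s(\vec x)$, $s''(\vec y)=s(\vec y)$, $s''(\vec z)=s'(\vec z)$; $X$ satisfies $\vec x\subseteq\vec y$ (inclusion; equal length, repetitions allowed) iff for every $s\in X$ there is $s'\in X$ with $s(\vec x)=s'(\vec y)$. $\Sigma\models\phi$ means every team $X$ (over any model) whose domain contains all variables of $\Sigma\cup\{\phi\}$ and which satisfies all atoms of $\Sigma$ also satisfies $\phi$. Graphs: consider graphs $G=(V,E)$ whose edges are non-directed edges $(u,w)_{ab}$ labelled by pairs $ab$ of variables (several labels may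 occur between the same pair of vertices; an edge $(u,w)_{ab}$ read from $w$ to $u$ is $(w,u)_{ba}$). Vertices $u,w$ are $ab$-connected, $u\sim_{ab}w$, if $u=w$ and $a=b$, or there are vertices $v_0,\ldots,v_n$ and variables $x_0,\ldots,x_n$ with $(u,v_0)_{ax_0},(v_0,v_1)_{x_0x_1},\ldots,(v_{n-1},v_n)_{x_{n-1}x_n},(v_n,w)_{x_nb}\in E$. The graph $G_{\Sigma,\phi}=(\bigcup_n V_n,\bigcup_n E_n)$: if $\phi$ is $\vec b\perp_{\vec a}\vec c$, then $V_0=\{v^+,v^-\}$ and $E_0=\{(v^+,v^-)_{aa}: a\in\vec a\}$; if $\phi$ is $\vec a\subseteq\vec b$, then $V_0=\{v\}$ and $E_0=\emptyset$. Given $G_n=(V_n,E_n)$: for every $v\in V_n$ and every $x_1\ldots x_k\subseteq y_1\ldots y_k\in\Sigma$, add a new vertex $v_{\rm new}$ and edges $(v,v_{\rm new})_{x_iy_i}$ for $1\le i\le k$; and for every $u,w\in V_n$ with $u\ne w$ and every $\vec y\perp_{\vec x}\vec z\in\Sigma$ such that $u\sim_{xx}w$ (in $G_n$) for all $x\in\vec x$, add a new vertex $v_{\rm new}$ and edges $(u,v_{\rm new})_{yy}$ for $y\in\vec x\vec y$ and $(w,v_{\rm new})_{zz}$ for $z\in\vec x\vec z$. $V_{n+1},E_{n+1}$ are obtained by adding these vertices and edges. *)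

theory Defs
  imports Main "HOL-Library.FuncSet"
begin

text \<open>\<open>Ind ys xs zs\<close> is the atom \<open>ys \<bottom>\<^sub>xs zs\<close> (the condition is the middle argument);
  \<open>Inc xs ys\<close> is \<open>xs \<subseteq> ys\<close>. Tuples are lists: they may be empty, overlap and contain repetitions.\<close>

datatype 'x atom =
    Ind "'x list" "'x list" "'x list"
  | Inc "'x list" "'x list"

primrec wf_atom :: "'x atom \<Rightarrow> bool" where
  "wf_atom (Ind ys xs zs) \<longleftrightarrow> True"
| "wf_atom (Inc xs ys) \<longleftrightarrow> length xs = length ys"

primrec vars_atom :: "'x atom \<Rightarrow> 'x set" where
  "vars_atom (Ind ys xs zs) = set ys \<union> set xs \<union> set zs"
| "vars_atom (Inc xs ys) = set xs \<union> set ys"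

text \<open>The domain \<open>D\<close> of a team is a separate argument because the empty team does not determine it.
  \<open>M\<close> is the domain of the model; the rest of the model is irrelevant to the atoms.\<close>

definition team :: "'m set \<Rightarrow> 'x set \<Rightarrow> ('x \<Rightarrow> 'm) set \<Rightarrow> bool" where
  "team M D X \<longleftrightarrow> finite D \<and> X \<subseteq> (D \<rightarrow>\<^sub>E M)"

primrec satisfies :: "('x \<Rightarrow> 'm) set \<Rightarrow> 'x atom \<Rightarrow> bool" where
  "satisfies X (Ind ys xs zs) \<longleftrightarrow>
     (\<forall>s\<in>X. \<forall>s'\<in>X. map s xs = map s' xs \<longrightarrow>
        (\<exists>s''\<in>X. map s'' xs = map s xs \<and> map s'' ys = map s ys \<and> map s'' zs = map s' zs))"
| "satisfies X (Inc xs ys) \<longleftrightarrow> (\<forall>s\<in>X. \<exists>s'\<in>X. map s xs = map s' ys)"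

text \<open>A definition cannot quantify over types, so the type \<open>'m\<close> that model domains are drawn from
  is a parameter. A model may have any nonempty subset of \<open>'m\<close> as its domain, so an infinite
  \<open>'m\<close> provides all finite model sizes as well.\<close>

definition entails :: "'m itself \<Rightarrow> 'x atom set \<Rightarrow> 'x atom \<Rightarrow> bool" where
  "entails (_ :: 'm itself) \<Sigma> \<phi> \<longleftrightarrow>
     (\<forall>(M :: 'm set) D X. M \<noteq> {} \<longrightarrow> team M D X \<longrightarrow> (\<Union>\<sigma>\<in>insert \<phi> \<Sigma>. vars_atom \<sigma>) \<subseteq> D \<longrightarrow>
        (\<forall>\<sigma>\<in>\<Sigma>. satisfies X \<sigma>) \<longrightarrow> satisfies X \<phi>)"

text \<open>The quadruple \<open>(u, w, a, b)\<close> stands for the non-directed edge \<open>(u,w)\<^sub>a\<^sub>b = (w,u)\<^sub>b\<^sub>a\<close>.\<close>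

record ('v, 'x) lgraph =
  verts :: "'v set"
  edges :: "('v \<times> 'v \<times> 'x \<times> 'x) set"

definition edge :: "('v, 'x) lgraph \<Rightarrow> 'v \<Rightarrow> 'v \<Rightarrow> 'x \<Rightarrow> 'x \<Rightarrow> bool" where
  "edge G u w a b \<longleftrightarrow> (u, w, a, b) \<in> edges G \<or> (w, u, b, a) \<in> edges G"

text \<open>\<open>connected_by G a b u w\<close> is \<open>u \<sim>\<^sub>a\<^sub>b w\<close>. A nontrivial path has at least two edges; a single edge
  still connects its ends, since it can be traversed three times.\<close>

definition connected_by :: "('v, 'x) lgraph \<Rightarrow> 'x \<Rightarrow> 'x \<Rightarrow> 'v \<Rightarrow> 'v \<Rightarrow> bool" where
  "connected_by G a b u w \<longleftrightarrow>
     u = w \<and> a = b \<or>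
     (\<exists>(n :: nat) v x. edge G u (v 0) a (x 0) \<and>
        (\<forall>i<n. edge G (v i) (v (Suc i)) (x i) (x (Suc i))) \<and>
        edge G (v n) w (x n) b)"

text \<open>A new vertex is named by the stage that adds it and by what it is added for, so that
  distinct additions, also for the same data at different stages, yield distinct vertices.\<close>

datatype 'x vertex =
    Init
  | InitPlus
  | InitMinus
  | NewInc nat "'x vertex" "'x list" "'x list"
  | NewInd nat "'x vertex" "'x vertex" "'x list" "'x list" "'x list"

primrec initial_graph :: "'x atom \<Rightarrow> ('x vertex, 'x) lgraph" where
  "initial_graph (Ind bs as cs) =
     \<lparr>verts = {InitPlus, InitMinus}, edges = {(InitPlus, InitMinus, a, a) | a. a \<in> set as}\<rparr>"
| "initial_graph (Inc as bs) = \<lparr>verts = {Init}, edges = {}\<rparr>"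

definition inc_steps ::
  "'x atom set \<Rightarrow> ('x vertex, 'x) lgraph \<Rightarrow> ('x vertex \<times> 'x list \<times> 'x list) set" where
  "inc_steps \<Sigma> G = {(v, xs, ys). v \<in> verts G \<and> Inc xs ys \<in> \<Sigma>}"

definition ind_steps ::
  "'x atom set \<Rightarrow> ('x vertex, 'x) lgraph \<Rightarrow>
     ('x vertex \<times> 'x vertex \<times> 'x list \<times> 'x list \<times> 'x list) set" where
  "ind_steps \<Sigma> G = {(u, w, ys, xs, zs). u \<in> verts G \<and> w \<in> verts G \<and> u \<noteq> w \<and>
     Ind ys xs zs \<in> \<Sigma> \<and> (\<forall>x\<in>set xs. connected_by G x x u w)}"

definition extend_graph ::
  "'x atom set \<Rightarrow> nat \<Rightarrow> ('x vertex, 'x) lgraph \<Rightarrow> ('x vertex, 'x) lgraph" where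
  "extend_graph \<Sigma> n G =
     \<lparr>verts = verts G
        \<union> {NewInc n v xs ys | v xs ys. (v, xs, ys) \<in> inc_steps \<Sigma> G}
        \<union> {NewInd n u w ys xs zs | u w ys xs zs. (u, w, ys, xs, zs) \<in> ind_steps \<Sigma> G},
      edges = edges G
        \<union> {(v, NewInc n v xs ys, xs ! i, ys ! i) | v xs ys i.
             (v, xs, ys) \<in> inc_steps \<Sigma> G \<and> i < length xs}
        \<union> {(u, NewInd n u w ys xs zs, y, y) | u w ys xs zs y.
             (u, w, ys, xs, zs) \<in> ind_steps \<Sigma> G \<and> y \<in> set xs \<union> set ys}
        \<union> {(w, NewInd n u w ys xs zs, z, z) | u w ys xs zs z.
             (u, w, ys, xs, zs) \<in> ind_steps \<Sigma> G \<and> z \<in> set xs \<union> set zs}\<rparr>"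

primrec stage :: "'x atom set \<Rightarrow> 'x atom \<Rightarrow> nat \<Rightarrow> ('x vertex, 'x) lgraph" where
  "stage \<Sigma> \<phi> 0 = initial_graph \<phi>"
| "stage \<Sigma> \<phi> (Suc n) = extend_graph \<Sigma> n (stage \<Sigma> \<phi> n)"

definition atom_graph :: "'x atom set \<Rightarrow> 'x atom \<Rightarrow> ('x vertex, 'x) lgraph" where
  "atom_graph \<Sigma> \<phi> =
     \<lparr>verts = (\<Union>n. verts (stage \<Sigma> \<phi> n)), edges = (\<Union>n. edges (stage \<Sigma> \<phi> n))\<rparr>"

end

theory Submission
  imports Defs "HOL-Library.Countable_Set"
begin

text \<open>Soundness: given a team \<open>X\<close> satisfying \<open>\<Sigma>\<close> and assignments for the initial vertices, every
  vertex of the graph can be sent recursively to an assignment in \<open>X\<close> so that an edge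
  \<open>(u,w)\<^sub>a\<^sub>b\<close> forces the images of \<open>u\<close> and \<open>w\<close> to agree at \<open>a\<close> and \<open>b\<close>; the image of the vertex
  given by the criterion is the required witness. Completeness: the relation \<open>u \<sim>\<^sub>a\<^sub>b w\<close> is an
  equivalence on pairs \<open>(u, a)\<close>, and mapping each vertex \<open>u\<close> to the assignment sending \<open>a\<close> to the
  class of \<open>(u, a)\<close> yields a team that satisfies \<open>\<Sigma>\<close> because of the vertices added at every
  stage. There are only countably many classes, so they can be named by elements of any infinite
  type.\<close>

section \<open>Connectivity as reachability between vertex-variable pairs\<close>

text \<open>Pairing each vertex with a variable turns labelled paths into ordinary chains of a
  symmetric relation: consecutive labels match exactly when the chain composes.\<close>

definition label_rel :: "('v, 'x) lgraph \<Rightarrow> (('v \<times> 'x) \<times> ('v \<times> 'x)) set" where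
  "label_rel G = {((u, a), (w, b)) | u a w b. edge G u w a b}"

lemma label_rel_iff [simp]: "((u, a), (w, b)) \<in> label_rel G \<longleftrightarrow> edge G u w a b"
  by (simp add: label_rel_def)

lemma edge_sym: "edge G u w a b \<Longrightarrow> edge G w u b a"
  by (auto simp: edge_def)

lemma sym_label_rel: "sym (label_rel G)"
  by (auto simp: sym_def label_rel_def intro: edge_sym)

lemma equiv_label_rel: "equiv UNIV ((label_rel G)\<^sup>*)"
  by (intro equivI) (auto simp: refl_on_def sym_rtrancl sym_label_rel trans_rtrancl)

text \<open>Chains of length zero and of length at least two are the two cases of
  \<open>connected_by\<close>. The remaining length one is reduced to length three by going back and
  forth along the edge.\<close>

lemma connected_by_iff_rtrancl:
  "connected_by G a b u w \<longleftrightarrow> ((u, a), (w, b)) \<in> (label_rel G)\<^sup>*"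
proof
  assume "connected_by G a b u w"
  then consider "u = w" "a = b"
    | (path) n v x where "edge G u (v 0) a (x 0)"
        "\<And>i. i < n \<Longrightarrow> edge G (v i) (v (Suc i)) (x i) (x (Suc i))"
        "edge G (v n) w (x n) b"
    unfolding connected_by_def by blast
  then show "((u, a), (w, b)) \<in> (label_rel G)\<^sup>*"
  proof cases
    case path
    have "((u, a), (v i, x i)) \<in> (label_rel G)\<^sup>*" if "i \<le> n" for i
      using that
    proof (induction i)
      case 0
      then show ?case using path(1) by (simp add: r_into_rtrancl)
    next
      case (Suc i)
      then have "((v i, x i), (v (Suc i), x (Suc i))) \<in> label_rel G" using path(2) by simp
      with Suc show ?case by (meson Suc_leD rtrancl.rtrancl_into_rtrancl)
    qed
    from this[of n] path(3) show ?thesis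
      by (meson label_rel_iff le_refl rtrancl.rtrancl_into_rtrancl)
  qed simp
next
  assume "((u, a), (w, b)) \<in> (label_rel G)\<^sup>*"
  then obtain k where k: "((u, a), (w, b)) \<in> label_rel G ^^ k"
    by (auto simp: rtrancl_power)
  have long: "connected_by G a b u w" if path: "((u, a), (w, b)) \<in> label_rel G ^^ Suc (Suc n)" for n
  proof -
    obtain f where f: "f 0 = (u, a)" "f (Suc (Suc n)) = (w, b)"
      and step: "\<And>i. i < Suc (Suc n) \<Longrightarrow> (f i, f (Suc i)) \<in> label_rel G"
      using path unfolding relpow_fun_conv by blast
    have "edge G (fst (f i)) (fst (f (Suc i))) (snd (f i)) (snd (f (Suc i)))"
      if "i < Suc (Suc n)" for i
      using step[OF that] by (metis label_rel_iff prod.collapse)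
    \<comment> \<open>The interior points \<open>f 1\<close>, ..., \<open>f (Suc n)\<close> of the
      chain become \<open>v 0\<close>, ..., \<open>v n\<close>, hence the shift by one; the first
      and last steps are the two end edges.\<close>
    from this[of 0] this[of "Suc n"] this[of "Suc _"] show ?thesis
      unfolding connected_by_def
      by (intro disjI2 exI[of _ n] exI[of _ "\<lambda>i. fst (f (Suc i))"]
          exI[of _ "\<lambda>i. snd (f (Suc i))"]) (simp add: f)
  qed
  consider "k = 0" | "k = 1" | n where "k = Suc (Suc n)"
    by (metis One_nat_def not0_implies_Suc)
  then show "connected_by G a b u w"
  proof cases
    case 1
    then show ?thesis using k by (simp add: connected_by_def)
  next
    case 2
    then have e: "edge G u w a b" using k by simp
    \<comment> \<open>Forward, backward and forward again along the same edge.\<close>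
    have "((u, a), (w, b)) \<in> label_rel G ^^ Suc (Suc (Suc 0))"
      using e edge_sym[OF e] by (auto simp: relcomp_unfold intro!: exI)
    then show ?thesis by (rule long)
  next
    case 3
    then show ?thesis using k long by blast
  qed
qed

lemma edge_connected_by: "edge G u w a b \<Longrightarrow> connected_by G a b u w"
  by (simp add: connected_by_iff_rtrancl r_into_rtrancl)

section \<open>Growth of the stages and passage to the limit graph\<close>

lemma edge_mono: "edges G \<subseteq> edges H \<Longrightarrow> edge G u w a b \<Longrightarrow> edge H u w a b"
  by (auto simp: edge_def)

lemma label_rel_mono: "edges G \<subseteq> edges H \<Longrightarrow> label_rel G \<subseteq> label_rel H"
  by (auto simp: label_rel_def dest: edge_mono)

lemma connected_by_mono:
  "edges G \<subseteq> edges H \<Longrightarrow> connected_by G a b u w \<Longrightarrow> connected_by H a b u w"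
  unfolding connected_by_iff_rtrancl using rtrancl_mono[OF label_rel_mono] by blast

lemma verts_stage_mono: "m \<le> n \<Longrightarrow> verts (stage \<Sigma> \<phi> m) \<subseteq> verts (stage \<Sigma> \<phi> n)"
  by (rule lift_Suc_mono_le[of "\<lambda>n. verts (stage \<Sigma> \<phi> n)"]) (auto simp: extend_graph_def)

lemma edges_stage_mono: "m \<le> n \<Longrightarrow> edges (stage \<Sigma> \<phi> m) \<subseteq> edges (stage \<Sigma> \<phi> n)"
  by (rule lift_Suc_mono_le[of "\<lambda>n. edges (stage \<Sigma> \<phi> n)"]) (auto simp: extend_graph_def)

lemma verts_stage_subset: "verts (stage \<Sigma> \<phi> n) \<subseteq> verts (atom_graph \<Sigma> \<phi>)"
  by (auto simp: atom_graph_def)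

lemma edges_stage_subset: "edges (stage \<Sigma> \<phi> n) \<subseteq> edges (atom_graph \<Sigma> \<phi>)"
  by (auto simp: atom_graph_def)

text \<open>A path has finitely many edges, each present from some stage on, so the whole path lies
  in one stage.\<close>

lemma connected_by_atom_graph_stage:
  assumes "connected_by (atom_graph \<Sigma> \<phi>) a b u w"
  shows "\<exists>n. connected_by (stage \<Sigma> \<phi> n) a b u w"
proof -
  have "\<exists>n. (p, q) \<in> (label_rel (stage \<Sigma> \<phi> n))\<^sup>*"
    if "(p, q) \<in> (label_rel (atom_graph \<Sigma> \<phi>))\<^sup>*" for p q
    using that
  proof induction
    case base
    show ?case by blast
  next
    case (step q r)
    then obtain m where m: "(p, q) \<in> (label_rel (stage \<Sigma> \<phi> m))\<^sup>*" by blast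
    obtain n where n: "(q, r) \<in> label_rel (stage \<Sigma> \<phi> n)"
      using step.hyps(2) unfolding label_rel_def edge_def atom_graph_def by fastforce
    have "(p, q) \<in> (label_rel (stage \<Sigma> \<phi> (max m n)))\<^sup>*"
      using m rtrancl_mono[OF label_rel_mono[OF edges_stage_mono]] max.cobounded1 by blast
    moreover have "(q, r) \<in> label_rel (stage \<Sigma> \<phi> (max m n))"
      using n label_rel_mono[OF edges_stage_mono] max.cobounded2 by blast
    ultimately show ?case by (meson rtrancl.rtrancl_into_rtrancl)
  qed
  with assms show ?thesis by (simp add: connected_by_iff_rtrancl)
qed

text \<open>The rule for independence atoms tests all variables of the condition at one and the same
  stage, so a stage uniform in \<open>x\<close> is required; finiteness of \<open>A\<close> provides
  it.\<close>

lemma all_connected_by_atom_graph_stage: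
  assumes "finite A" and "\<forall>x\<in>A. connected_by (atom_graph \<Sigma> \<phi>) x x u w"
  shows "\<exists>n. \<forall>m\<ge>n. \<forall>x\<in>A. connected_by (stage \<Sigma> \<phi> m) x x u w"
proof -
  have "\<exists>n. \<forall>m\<ge>n. connected_by (stage \<Sigma> \<phi> m) x x u w" if "x \<in> A" for x
    using connected_by_atom_graph_stage connected_by_mono[OF edges_stage_mono] assms(2) that
    by metis
  then obtain N where N: "\<And>x m. x \<in> A \<Longrightarrow> m \<ge> N x \<Longrightarrow> connected_by (stage \<Sigma> \<phi> m) x x u w"
    by metis
  \<comment> \<open>The largest threshold serves all of \<open>A\<close>. For empty \<open>A\<close>
    the value of \<open>Max\<close> is irrelevant, as there is nothing to verify.\<close>
  have "N x \<le> Max (N ` A)" if "x \<in> A" for x using assms(1) that by simp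
  with N show ?thesis by (meson order_trans)
qed

section \<open>Closure of the limit graph under both construction rules\<close>

lemma atom_graph_inc_vertex:
  assumes "Inc xs ys \<in> \<Sigma>" and "v \<in> verts (atom_graph \<Sigma> \<phi>)"
  obtains w where "w \<in> verts (atom_graph \<Sigma> \<phi>)"
    and "\<And>i. i < length xs \<Longrightarrow> edge (atom_graph \<Sigma> \<phi>) v w (xs ! i) (ys ! i)"
proof -
  obtain n where n: "v \<in> verts (stage \<Sigma> \<phi> n)" using assms(2) by (auto simp: atom_graph_def)
  then have step: "(v, xs, ys) \<in> inc_steps \<Sigma> (stage \<Sigma> \<phi> n)"
    using assms(1) by (simp add: inc_steps_def)
  show ?thesis
  proof (rule that[of "NewInc n v xs ys"])
    have "NewInc n v xs ys \<in> verts (stage \<Sigma> \<phi> (Suc n))"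
      using step by (auto simp: extend_graph_def)
    then show "NewInc n v xs ys \<in> verts (atom_graph \<Sigma> \<phi>)" using verts_stage_subset by blast
  next
    fix i assume "i < length xs"
    then have "edge (stage \<Sigma> \<phi> (Suc n)) v (NewInc n v xs ys) (xs ! i) (ys ! i)"
      using step by (auto simp: extend_graph_def edge_def)
    then show "edge (atom_graph \<Sigma> \<phi>) v (NewInc n v xs ys) (xs ! i) (ys ! i)"
      by (rule edge_mono[OF edges_stage_subset])
  qed
qed

text \<open>Both vertices and all connecting paths are present at a common stage \<open>n\<close>;
  the rule then fires there and adds the vertex at stage \<open>Suc n\<close>.\<close>

lemma atom_graph_ind_vertex:
  assumes "Ind ys xs zs \<in> \<Sigma>" and "u \<in> verts (atom_graph \<Sigma> \<phi>)" "w \<in> verts (atom_graph \<Sigma> \<phi>)"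
    and "u \<noteq> w" and "\<forall>x\<in>set xs. connected_by (atom_graph \<Sigma> \<phi>) x x u w"
  obtains v where "v \<in> verts (atom_graph \<Sigma> \<phi>)"
    and "\<And>y. y \<in> set xs \<union> set ys \<Longrightarrow> edge (atom_graph \<Sigma> \<phi>) u v y y"
    and "\<And>z. z \<in> set xs \<union> set zs \<Longrightarrow> edge (atom_graph \<Sigma> \<phi>) w v z z"
proof -
  obtain k l where kl: "u \<in> verts (stage \<Sigma> \<phi> k)" "w \<in> verts (stage \<Sigma> \<phi> l)"
    using assms(2,3) by (auto simp: atom_graph_def)
  obtain m where m: "\<forall>n\<ge>m. \<forall>x\<in>set xs. connected_by (stage \<Sigma> \<phi> n) x x u w"
    using all_connected_by_atom_graph_stage[OF _ assms(5)] by blast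
  obtain n where le: "k \<le> n" "l \<le> n" "m \<le> n"
    by (metis linear order_trans)
  have "u \<in> verts (stage \<Sigma> \<phi> n)" "w \<in> verts (stage \<Sigma> \<phi> n)"
    using kl verts_stage_mono[OF le(1)] verts_stage_mono[OF le(2)] by blast+
  then have step: "(u, w, ys, xs, zs) \<in> ind_steps \<Sigma> (stage \<Sigma> \<phi> n)"
    using assms(1,4) m le(3) by (simp add: ind_steps_def)
  let ?v = "NewInd n u w ys xs zs"
  show ?thesis
  proof (rule that[of ?v])
    have "?v \<in> verts (stage \<Sigma> \<phi> (Suc n))"
      using step by (auto simp: extend_graph_def)
    then show "?v \<in> verts (atom_graph \<Sigma> \<phi>)" using verts_stage_subset by blast
  next
    fix y assume "y \<in> set xs \<union> set ys"
    then have "edge (stage \<Sigma> \<phi> (Suc n)) u ?v y y"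
      using step by (auto simp: extend_graph_def edge_def)
    then show "edge (atom_graph \<Sigma> \<phi>) u ?v y y"
      by (rule edge_mono[OF edges_stage_subset])
  next
    fix z assume "z \<in> set xs \<union> set zs"
    then have "edge (stage \<Sigma> \<phi> (Suc n)) w ?v z z"
      using step by (auto simp: extend_graph_def edge_def)
    then show "edge (atom_graph \<Sigma> \<phi>) w ?v z z"
      by (rule edge_mono[OF edges_stage_subset])
  qed
qed

section \<open>Finiteness of the stages and countability of the graph\<close>

lemma finite_inc_steps:
  assumes "finite \<Sigma>" and "finite (verts G)"
  shows "finite (inc_steps \<Sigma> G)"
proof -
  \<comment> \<open>The constructor is injective, so finitely many atoms come from finitely many
    pairs of tuples.\<close>
  have "finite ((\<lambda>(xs, ys). Inc xs ys) -` \<Sigma>)"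
    using assms(1) by (rule finite_vimageI) (auto simp: inj_def)
  moreover have "inc_steps \<Sigma> G \<subseteq> verts G \<times> (\<lambda>(xs, ys). Inc xs ys) -` \<Sigma>"
    by (auto simp: inc_steps_def)
  ultimately show ?thesis using assms(2) by (meson finite_SigmaI finite_subset)
qed

lemma finite_ind_steps:
  assumes "finite \<Sigma>" and "finite (verts G)"
  shows "finite (ind_steps \<Sigma> G)"
proof -
  have "finite ((\<lambda>(ys, xs, zs). Ind ys xs zs) -` \<Sigma>)"
    using assms(1) by (rule finite_vimageI) (auto simp: inj_def)
  moreover have "ind_steps \<Sigma> G \<subseteq> verts G \<times> verts G \<times> (\<lambda>(ys, xs, zs). Ind ys xs zs) -` \<Sigma>"
    by (auto simp: ind_steps_def)
  ultimately show ?thesis using assms(2) by (meson finite_SigmaI finite_subset)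
qed

lemma finite_verts_stage:
  assumes "finite \<Sigma>"
  shows "finite (verts (stage \<Sigma> \<phi> n))"
proof (induction n)
  case 0
  show ?case by (cases \<phi>) auto
next
  case (Suc n)
  let ?G = "stage \<Sigma> \<phi> n"
  have "verts (stage \<Sigma> \<phi> (Suc n)) = verts ?G
      \<union> (\<lambda>(v, xs, ys). NewInc n v xs ys) ` inc_steps \<Sigma> ?G
      \<union> (\<lambda>(u, w, ys, xs, zs). NewInd n u w ys xs zs) ` ind_steps \<Sigma> ?G"
    by (force simp: extend_graph_def)
  with Suc show ?case
    using finite_inc_steps[OF assms Suc] finite_ind_steps[OF assms Suc] by simp
qed

lemma countable_verts_atom_graph: "finite \<Sigma> \<Longrightarrow> countable (verts (atom_graph \<Sigma> \<phi>))"
  by (auto simp: atom_graph_def intro: countable_finite finite_verts_stage)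

section \<open>Soundness: realizing the graph inside a team\<close>

text \<open>Testing the stored orientation of an edge suffices, since the required equation is
  symmetric.\<close>

definition respects_edges :: "('v \<Rightarrow> 'x \<Rightarrow> 'm) \<Rightarrow> ('v, 'x) lgraph \<Rightarrow> bool" where
  "respects_edges f G \<longleftrightarrow> (\<forall>(u, w, a, b)\<in>edges G. f u a = f w b)"

lemma respects_edges_connected_by:
  assumes "respects_edges f G" and "connected_by G a b u w"
  shows "f u a = f w b"
proof -
  have "f (fst p) (snd p) = f (fst q) (snd q)" if "(p, q) \<in> (label_rel G)\<^sup>*" for p q
    using that
  proof induction
    case (step q r)
    then have "f (fst q) (snd q) = f (fst r) (snd r)"
      using assms(1) by (auto simp: respects_edges_def label_rel_def edge_def)
    with step show ?case by simp
  qed simp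
  from this[of "(u, a)" "(w, b)"] assms(2) show ?thesis
    by (simp add: connected_by_iff_rtrancl)
qed

text \<open>The name of a vertex records the vertices and the atom it was added for, so the
  recursion runs over names and not over stages. The choices are meaningful for vertices of the
  graph, where a suitable \<open>t\<close> exists.\<close>

primrec realize :: "('x \<Rightarrow> 'm) set \<Rightarrow> ('x \<Rightarrow> 'm) \<Rightarrow> ('x \<Rightarrow> 'm) \<Rightarrow> 'x vertex \<Rightarrow> 'x \<Rightarrow> 'm" where
  "realize X s s' Init = s"
| "realize X s s' InitPlus = s"
| "realize X s s' InitMinus = s'"
| "realize X s s' (NewInc n v xs ys) = (SOME t. t \<in> X \<and> map (realize X s s' v) xs = map t ys)"
| "realize X s s' (NewInd n u w ys xs zs) =
     (SOME t. t \<in> X \<and> map t xs = map (realize X s s' u) xs \<and>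
        map t ys = map (realize X s s' u) ys \<and> map t zs = map (realize X s s' w) zs)"

text \<open>Both claims go through one induction: membership in \<open>X\<close> lets the atoms of
  \<Sigma> be applied to the images of old vertices, and respected edges turn the connectedness
  tested by an independence step into the agreement on \<open>xs\<close> that the atom
  presupposes.\<close>

lemma realize_stage:
  assumes sat: "\<forall>\<sigma>\<in>\<Sigma>. satisfies X \<sigma>" and wf: "\<forall>\<sigma>\<in>\<Sigma>. wf_atom \<sigma>"
    and init: "s \<in> X" "s' \<in> X" "\<forall>bs as cs. \<phi> = Ind bs as cs \<longrightarrow> map s as = map s' as"
  shows "realize X s s' ` verts (stage \<Sigma> \<phi> n) \<subseteq> X \<and>
    respects_edges (realize X s s') (stage \<Sigma> \<phi> n)"
proof (induction n)
  case 0
  show ?case using init by (cases \<phi>) (auto simp: respects_edges_def)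
next
  case (Suc n)
  let ?f = "realize X s s'" and ?G = "stage \<Sigma> \<phi> n"
  have inc_new: "?f (NewInc n v xs ys) \<in> X \<and> map (?f v) xs = map (?f (NewInc n v xs ys)) ys \<and>
      length xs = length ys"
    if "(v, xs, ys) \<in> inc_steps \<Sigma> ?G" for v xs ys
  proof -
    have "?f v \<in> X" "satisfies X (Inc xs ys)" "wf_atom (Inc xs ys)"
      using that Suc sat wf by (auto simp: inc_steps_def)
    \<comment> \<open>The inclusion atom, applied to the image of \<open>v\<close>, yields a
      candidate, so the choice in \<open>realize\<close> succeeds.\<close>
    then have "\<exists>t. t \<in> X \<and> map (?f v) xs = map t ys" by auto
    from someI_ex[OF this] \<open>wf_atom (Inc xs ys)\<close> show ?thesis by simp
  qed
  have ind_new: "?f (NewInd n u w ys xs zs) \<in> X \<and>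
      (\<forall>y\<in>set xs \<union> set ys. ?f u y = ?f (NewInd n u w ys xs zs) y) \<and>
      (\<forall>z\<in>set xs \<union> set zs. ?f w z = ?f (NewInd n u w ys xs zs) z)"
    if "(u, w, ys, xs, zs) \<in> ind_steps \<Sigma> ?G" for u w ys xs zs
  proof -
    have X: "?f u \<in> X" "?f w \<in> X" "satisfies X (Ind ys xs zs)"
      using that Suc sat by (auto simp: ind_steps_def)
    have eq: "\<forall>x\<in>set xs. ?f u x = ?f w x"
      using that Suc by (auto simp: ind_steps_def intro: respects_edges_connected_by)
    then have "map (?f u) xs = map (?f w) xs" by simp
    with X have "\<exists>t. t \<in> X \<and> map t xs = map (?f u) xs \<and> map t ys = map (?f u) ys \<and>
        map t zs = map (?f w) zs"
      unfolding satisfies.simps by blast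
    \<comment> \<open>The choice prescribes the values on \<open>xs\<close> through \<open>u\<close>
      only; \<open>eq\<close> carries them over to \<open>w\<close>.\<close>
    from someI_ex[OF this] eq show ?thesis by auto
  qed
  \<comment> \<open>The choice equations stay folded so that \<open>inc_new\<close> and
    \<open>ind_new\<close> describe the new vertices.\<close>
  have "?f v \<in> X" if "v \<in> verts (stage \<Sigma> \<phi> (Suc n))" for v
    using that Suc inc_new ind_new by (auto simp: extend_graph_def simp del: realize.simps(4,5))
  moreover have "?f u a = ?f w b" if "(u, w, a, b) \<in> edges (stage \<Sigma> \<phi> (Suc n))" for u w a b
  proof -
    from that consider "(u, w, a, b) \<in> edges ?G"
      | (inc) xs ys i where "(u, xs, ys) \<in> inc_steps \<Sigma> ?G" "i < length xs"
          "w = NewInc n u xs ys" "a = xs ! i" "b = ys ! i"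
      | (left) v ys xs zs where "(u, v, ys, xs, zs) \<in> ind_steps \<Sigma> ?G" "a \<in> set xs \<union> set ys"
          "w = NewInd n u v ys xs zs" "b = a"
      | (right) v ys xs zs where "(v, u, ys, xs, zs) \<in> ind_steps \<Sigma> ?G" "a \<in> set xs \<union> set zs"
          "w = NewInd n v u ys xs zs" "b = a"
      by (auto simp: extend_graph_def)
    then show ?thesis
    proof cases
      case 1
      then show ?thesis using Suc by (auto simp: respects_edges_def)
    next
      case inc
      with inc_new[OF inc(1)] show ?thesis
        by (metis nth_map)
    next
      case left
      with ind_new[OF left(1)] show ?thesis by blast
    next
      case right
      with ind_new[OF right(1)] show ?thesis by blast
    qed
  qed
  ultimately show ?case by (auto simp: respects_edges_def)
qed

lemma realize_atom_graph:
  assumes "\<forall>\<sigma>\<in>\<Sigma>. satisfies X \<sigma>" and "\<forall>\<sigma>\<in>\<Sigma>. wf_atom \<sigma>"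
    and "s \<in> X" "s' \<in> X" "\<forall>bs as cs. \<phi> = Ind bs as cs \<longrightarrow> map s as = map s' as"
  shows "v \<in> verts (atom_graph \<Sigma> \<phi>) \<Longrightarrow> realize X s s' v \<in> X"
    and "connected_by (atom_graph \<Sigma> \<phi>) a b u w \<Longrightarrow> realize X s s' u a = realize X s s' w b"
proof -
  note stage = realize_stage[OF assms]
  show "v \<in> verts (atom_graph \<Sigma> \<phi>) \<Longrightarrow> realize X s s' v \<in> X"
    using stage by (auto simp: atom_graph_def)
  assume "connected_by (atom_graph \<Sigma> \<phi>) a b u w"
  from connected_by_atom_graph_stage[OF this]
  obtain n where "connected_by (stage \<Sigma> \<phi> n) a b u w" ..
  with stage show "realize X s s' u a = realize X s s' w b"
    by (intro respects_edges_connected_by) auto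
qed

text \<open>The image of \<open>w\<close> is the required witness: the paths from
  \<open>Init\<close>, whose image is \<open>s\<close>, carry the value of \<open>s\<close> at each
  \<open>as ! i\<close> over to \<open>bs ! i\<close>.\<close>

lemma satisfies_Inc_if_connected:
  assumes "\<forall>\<sigma>\<in>\<Sigma>. satisfies X \<sigma>" and "\<forall>\<sigma>\<in>\<Sigma>. wf_atom \<sigma>" and "length as = length bs"
    and w: "w \<in> verts (atom_graph \<Sigma> (Inc as bs))"
      "\<forall>i<length as. connected_by (atom_graph \<Sigma> (Inc as bs)) (as ! i) (bs ! i) Init w"
  shows "satisfies X (Inc as bs)"
  unfolding satisfies.simps
proof
  fix s assume s: "s \<in> X"
  \<comment> \<open>The graph of an inclusion atom has a single initial vertex, so \<open>s\<close>
    fills both starting positions.\<close>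
  note r = realize_atom_graph[OF assms(1,2) s s, of "Inc as bs"]
  have "map s as = map (realize X s s w) bs"
  proof (rule nth_equalityI)
    fix i assume "i < length (map s as)"
    then show "map s as ! i = map (realize X s s w) bs ! i"
      using r(2)[of "as ! i" "bs ! i" Init w] w(2) assms(3) by simp
  qed (simp add: assms(3))
  then show "\<exists>s'\<in>X. map s as = map s' bs" using r(1)[OF _ w(1)] by auto
qed

text \<open>With \<open>InitPlus\<close> sent to \<open>s\<close> and \<open>InitMinus\<close> to
  \<open>s'\<close>, the initial edges are respected because both agree on \<open>as\<close>; the
  image of \<open>v\<close> then combines the two assignments.\<close>

lemma satisfies_Ind_if_connected:
  assumes "\<forall>\<sigma>\<in>\<Sigma>. satisfies X \<sigma>" and "\<forall>\<sigma>\<in>\<Sigma>. wf_atom \<sigma>"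
    and v: "v \<in> verts (atom_graph \<Sigma> (Ind bs as cs))"
      "\<forall>b\<in>set as \<union> set bs. connected_by (atom_graph \<Sigma> (Ind bs as cs)) b b InitPlus v"
      "\<forall>c\<in>set as \<union> set cs. connected_by (atom_graph \<Sigma> (Ind bs as cs)) c c InitMinus v"
  shows "satisfies X (Ind bs as cs)"
  unfolding satisfies.simps
proof (intro ballI impI)
  fix s s' assume s: "s \<in> X" "s' \<in> X" "map s as = map s' as"
  note r = realize_atom_graph[OF assms(1,2) s(1,2), of "Ind bs as cs"]
  let ?t = "realize X s s' v"
  have "?t \<in> X" using r(1)[OF _ v(1)] s(3) by auto
  moreover have "s b = ?t b" if "b \<in> set as \<union> set bs" for b
    using r(2)[of b b InitPlus v] that v(2) s(3) by simp
  moreover have "s' c = ?t c" if "c \<in> set as \<union> set cs" for c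
    using r(2)[of c c InitMinus v] that v(3) s(3) by simp
  ultimately show "\<exists>s''\<in>X. map s'' as = map s as \<and> map s'' bs = map s bs \<and> map s'' cs = map s' cs"
    by (intro bexI[of _ ?t]) auto
qed

section \<open>Completeness: the canonical team of connectivity classes\<close>

lemma countable_inj_into_infinite:
  assumes "countable A" and "infinite (UNIV :: 'm set)"
  shows "\<exists>g :: 'a \<Rightarrow> 'm. inj_on g A"
proof -
  obtain f :: "'a \<Rightarrow> nat" where "inj_on f A" using assms(1) by (rule countableE)
  moreover obtain h :: "nat \<Rightarrow> 'm" where "inj h"
    using infinite_countable_subset[OF assms(2)] by blast
  ultimately show ?thesis by (blast intro: comp_inj_on inj_on_subset)
qed

text \<open>The value of \<open>u\<close> at \<open>a\<close> is an element of \<open>'m\<close>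
  naming the class of \<open>(u, a)\<close> under reachability. Finite stages and finite
  \<open>D\<close> leave only countably many classes to name.\<close>

lemma ex_canonical_valuation:
  assumes "finite \<Sigma>" and "finite D" and "infinite (UNIV :: 'm set)"
  shows "\<exists>f :: 'x vertex \<Rightarrow> 'x \<Rightarrow> 'm.
    \<forall>u\<in>verts (atom_graph \<Sigma> \<phi>). \<forall>w\<in>verts (atom_graph \<Sigma> \<phi>). \<forall>a\<in>D. \<forall>b\<in>D.
      f u a = f w b \<longleftrightarrow> connected_by (atom_graph \<Sigma> \<phi>) a b u w"
proof -
  let ?G = "atom_graph \<Sigma> \<phi>"
  let ?cls = "\<lambda>p. (label_rel ?G)\<^sup>* `` {p}"
  have "countable (?cls ` (verts ?G \<times> D))"
    using assms(1,2) by (intro countable_image countable_SIGMA countable_verts_atom_graph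
        countable_finite)
  then obtain g :: "_ \<Rightarrow> 'm" where g: "inj_on g (?cls ` (verts ?G \<times> D))"
    using countable_inj_into_infinite[OF _ assms(3)] by blast
  have "g (?cls (u, a)) = g (?cls (w, b)) \<longleftrightarrow> connected_by ?G a b u w"
    if "u \<in> verts ?G" "w \<in> verts ?G" "a \<in> D" "b \<in> D" for u w a b
  proof -
    have "g (?cls (u, a)) = g (?cls (w, b)) \<longleftrightarrow> ?cls (u, a) = ?cls (w, b)"
      using that by (intro inj_on_eq_iff[OF g] imageI) auto
    also have "\<dots> \<longleftrightarrow> connected_by ?G a b u w"
      using eq_equiv_class_iff[OF equiv_label_rel] by (simp add: connected_by_iff_rtrancl)
    finally show ?thesis .
  qed
  then show ?thesis by (intro exI[of _ "\<lambda>u a. g (?cls (u, a))"]) blast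
qed

text \<open>Equal values mean connectedness, so the closure of the graph under the two rules is
  exactly what makes the team satisfy \<Sigma>; entailment then yields \<phi>.\<close>

lemma ex_canonical_team:
  assumes fin: "finite \<Sigma>" and wf: "\<forall>\<sigma>\<in>insert \<phi> \<Sigma>. wf_atom \<sigma>"
    and inf: "infinite (UNIV :: 'm set)"
    and ent: "entails TYPE('m) \<Sigma> \<phi>"
  obtains f :: "'x vertex \<Rightarrow> 'x \<Rightarrow> 'm" where
    "satisfies (f ` verts (atom_graph \<Sigma> \<phi>)) \<phi>"
    and "\<And>u w a b. u \<in> verts (atom_graph \<Sigma> \<phi>) \<Longrightarrow> w \<in> verts (atom_graph \<Sigma> \<phi>) \<Longrightarrow>
      a \<in> vars_atom \<phi> \<Longrightarrow> b \<in> vars_atom \<phi> \<Longrightarrow>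
      f u a = f w b \<longleftrightarrow> connected_by (atom_graph \<Sigma> \<phi>) a b u w"
proof -
  let ?G = "atom_graph \<Sigma> \<phi>"
  define D where "D = (\<Union>\<sigma>\<in>insert \<phi> \<Sigma>. vars_atom \<sigma>)"
  have "finite (vars_atom \<sigma>)" for \<sigma> :: "'x atom" by (cases \<sigma>) auto
  with fin have D: "finite D" by (simp add: D_def)
  obtain f0 :: "'x vertex \<Rightarrow> 'x \<Rightarrow> 'm" where
    f0: "\<forall>u\<in>verts ?G. \<forall>w\<in>verts ?G. \<forall>a\<in>D. \<forall>b\<in>D. f0 u a = f0 w b \<longleftrightarrow> connected_by ?G a b u w"
    using ex_canonical_valuation[OF fin D inf] by blast
  \<comment> \<open>A team with domain \<open>D\<close> consists of extensional functions on
    \<open>D\<close>.\<close>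
  define f where "f u = restrict (f0 u) D" for u
  have f: "f u a = f w b \<longleftrightarrow> connected_by ?G a b u w"
    if "u \<in> verts ?G" "w \<in> verts ?G" "a \<in> D" "b \<in> D" for u w a b
    using that f0 by (simp add: f_def)
  have "satisfies (f ` verts ?G) \<sigma>" if \<sigma>: "\<sigma> \<in> \<Sigma>" for \<sigma>
  proof (cases \<sigma>)
    case (Inc xs ys)
    have len: "length xs = length ys" using wf \<sigma> Inc by auto
    have sub: "set xs \<subseteq> D" "set ys \<subseteq> D" using \<sigma> Inc by (force simp: D_def)+
    have "\<exists>w\<in>verts ?G. map (f u) xs = map (f w) ys" if u: "u \<in> verts ?G" for u
    proof -
      obtain w where w: "w \<in> verts ?G"
        "\<And>i. i < length xs \<Longrightarrow> edge ?G u w (xs ! i) (ys ! i)"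
        using atom_graph_inc_vertex[OF _ u, of xs ys] \<sigma> Inc by blast
      have "map (f u) xs = map (f w) ys"
      proof (rule nth_equalityI)
        fix i assume "i < length (map (f u) xs)"
        then have i: "i < length xs" by simp
        then have "xs ! i \<in> D" "ys ! i \<in> D" using sub len by (auto simp: subset_iff)
        then show "map (f u) xs ! i = map (f w) ys ! i"
          using f[OF u w(1)] edge_connected_by[OF w(2)[OF i]] i len by simp
      qed (simp add: len)
      with w(1) show ?thesis by blast
    qed
    then show ?thesis by (simp add: Inc)
  next
    case (Ind ys xs zs)
    have sub: "set xs \<subseteq> D" "set ys \<subseteq> D" "set zs \<subseteq> D" using \<sigma> Ind by (force simp: D_def)+
    have "\<exists>v\<in>verts ?G. map (f v) xs = map (f u) xs \<and> map (f v) ys = map (f u) ys \<and>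
        map (f v) zs = map (f w) zs"
      if u: "u \<in> verts ?G" and w: "w \<in> verts ?G" and eq: "map (f u) xs = map (f w) xs" for u w
    proof (cases "u = w")
      \<comment> \<open>The construction adds vertices for distinct pairs only; here
        \<open>u\<close> itself is the witness.\<close>
      case True
      with u show ?thesis by blast
    next
      case False
      \<comment> \<open>Agreement of the assignments on \<open>xs\<close> is read back as
        connectedness, the premise of the independence rule.\<close>
      have "connected_by ?G x x u w" if "x \<in> set xs" for x
        using f[OF u w, of x x] eq that sub by auto
      then obtain v where v: "v \<in> verts ?G"
        "\<And>y. y \<in> set xs \<union> set ys \<Longrightarrow> edge ?G u v y y"
        "\<And>z. z \<in> set xs \<union> set zs \<Longrightarrow> edge ?G w v z z"
        using atom_graph_ind_vertex[OF _ u w False] \<sigma> Ind by blast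
      have "f u y = f v y" if "y \<in> set xs \<union> set ys" for y
        using f[OF u v(1), of y y] edge_connected_by[OF v(2)[OF that]] that sub by auto
      moreover have "f w z = f v z" if "z \<in> set zs" for z
        using f[OF w v(1), of z z] edge_connected_by[OF v(3), of z] that sub by auto
      ultimately show ?thesis using v(1) by (intro bexI[of _ v]) auto
    qed
    then show ?thesis by (simp add: Ind)
  qed
  moreover have "team UNIV D (f ` verts ?G)"
    using D by (auto simp: team_def f_def)
  ultimately have "satisfies (f ` verts ?G) \<phi>"
    using ent unfolding entails_def D_def by blast
  moreover have "vars_atom \<phi> \<subseteq> D" by (auto simp: D_def)
  ultimately show ?thesis using that[of f] f by (meson subsetD)
qed

section \<open>Necessity of the criteria, and the two equivalences\<close>

lemma initial_verts_subset: "verts (initial_graph \<phi>) \<subseteq> verts (atom_graph \<Sigma> \<phi>)"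
  using verts_stage_subset[of \<Sigma> \<phi> 0] by simp

text \<open>In the canonical team, the inclusion atom applied to the assignment of
  \<open>Init\<close> returns the assignment of some vertex \<open>w\<close>; equal values translate
  into paths.\<close>

lemma connected_if_entails_Inc:
  assumes "finite \<Sigma>" and wf: "\<forall>\<sigma>\<in>insert (Inc as bs) \<Sigma>. wf_atom \<sigma>"
    and "infinite (UNIV :: 'm set)" and "entails TYPE('m) \<Sigma> (Inc as bs)"
  shows "\<exists>w\<in>verts (atom_graph \<Sigma> (Inc as bs)). \<forall>i<length as.
    connected_by (atom_graph \<Sigma> (Inc as bs)) (as ! i) (bs ! i) Init w"
proof -
  let ?G = "atom_graph \<Sigma> (Inc as bs)"
  obtain f :: "'a vertex \<Rightarrow> 'a \<Rightarrow> 'm" where sat: "satisfies (f ` verts ?G) (Inc as bs)"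
    and f: "\<And>u w a b. u \<in> verts ?G \<Longrightarrow> w \<in> verts ?G \<Longrightarrow> a \<in> vars_atom (Inc as bs) \<Longrightarrow>
      b \<in> vars_atom (Inc as bs) \<Longrightarrow> f u a = f w b \<longleftrightarrow> connected_by ?G a b u w"
    using ex_canonical_team[OF assms] by blast
  have init: "Init \<in> verts ?G" using initial_verts_subset[of "Inc as bs" \<Sigma>] by simp
  with sat obtain w where w: "w \<in> verts ?G" "map (f Init) as = map (f w) bs" by auto
  have "connected_by ?G (as ! i) (bs ! i) Init w" if i: "i < length as" for i
  proof -
    have "i < length bs" using wf i by simp
    moreover from this have "f Init (as ! i) = f w (bs ! i)" using w(2) i by (metis nth_map)
    ultimately show ?thesis using f[OF init w(1)] i by simp
  qed
  with w(1) show ?thesis by blast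
qed

text \<open>The independence atom is applied in the canonical team to the assignments of the two
  initial vertices; the vertex of the resulting assignment is \<open>v\<close>.\<close>

lemma connected_if_entails_Ind:
  assumes "finite \<Sigma>" and "\<forall>\<sigma>\<in>insert (Ind bs as cs) \<Sigma>. wf_atom \<sigma>"
    and "infinite (UNIV :: 'm set)" and "entails TYPE('m) \<Sigma> (Ind bs as cs)"
  shows "\<exists>v\<in>verts (atom_graph \<Sigma> (Ind bs as cs)).
    (\<forall>b\<in>set as \<union> set bs. connected_by (atom_graph \<Sigma> (Ind bs as cs)) b b InitPlus v) \<and>
    (\<forall>c\<in>set as \<union> set cs. connected_by (atom_graph \<Sigma> (Ind bs as cs)) c c InitMinus v)"
proof -
  let ?G = "atom_graph \<Sigma> (Ind bs as cs)"
  obtain f :: "'a vertex \<Rightarrow> 'a \<Rightarrow> 'm" where sat: "satisfies (f ` verts ?G) (Ind bs as cs)"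
    and f: "\<And>u w a b. u \<in> verts ?G \<Longrightarrow> w \<in> verts ?G \<Longrightarrow> a \<in> vars_atom (Ind bs as cs) \<Longrightarrow>
      b \<in> vars_atom (Ind bs as cs) \<Longrightarrow> f u a = f w b \<longleftrightarrow> connected_by ?G a b u w"
    using ex_canonical_team[OF assms] by blast
  have init: "InitPlus \<in> verts ?G" "InitMinus \<in> verts ?G"
    using initial_verts_subset[of "Ind bs as cs" \<Sigma>] by auto
  \<comment> \<open>The initial edges make the two assignments agree on \<open>as\<close>, as the
    atom presupposes.\<close>
  have "edge ?G InitPlus InitMinus a a" if "a \<in> set as" for a
    using edges_stage_subset[of \<Sigma> "Ind bs as cs" 0] that by (auto simp: edge_def)
  then have pm: "f InitPlus a = f InitMinus a" if "a \<in> set as" for a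
    using f[OF init, of a a] that edge_connected_by[of ?G InitPlus InitMinus a a] by simp
  then have "map (f InitPlus) as = map (f InitMinus) as" by simp
  with sat init obtain v where v: "v \<in> verts ?G" "map (f v) as = map (f InitPlus) as"
    "map (f v) bs = map (f InitPlus) bs" "map (f v) cs = map (f InitMinus) cs"
    unfolding satisfies.simps by blast
  have "connected_by ?G b b InitPlus v" if "b \<in> set as \<union> set bs" for b
    using f[OF init(1) v(1), of b b] v(2,3) that by auto
  \<comment> \<open>On \<open>as\<close> the vertex \<open>v\<close> is known to agree with
    \<open>InitPlus\<close>; \<open>pm\<close> transfers this to \<open>InitMinus\<close>.\<close>
  moreover have "connected_by ?G c c InitMinus v" if "c \<in> set as \<union> set cs" for c
    using f[OF init(2) v(1), of c c] v(2,4) that pm by auto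
  ultimately show ?thesis using v(1) by blast
qed

theorem theorem11:
  fixes \<Sigma> :: "'x atom set" and \<phi> :: "'x atom"
  assumes "finite \<Sigma>"
    and "\<forall>\<sigma>\<in>insert \<phi> \<Sigma>. wf_atom \<sigma>"
    and "infinite (UNIV :: 'm set)"
  shows "(\<forall>as bs. \<phi> = Inc as bs \<longrightarrow>
            (entails TYPE('m) \<Sigma> \<phi> \<longleftrightarrow>
               (\<exists>w\<in>verts (atom_graph \<Sigma> \<phi>). \<forall>i<length as.
                  connected_by (atom_graph \<Sigma> \<phi>) (as ! i) (bs ! i) Init w)))
       \<and> (\<forall>bs as cs. \<phi> = Ind bs as cs \<longrightarrow>
            (entails TYPE('m) \<Sigma> \<phi> \<longleftrightarrow>
               (\<exists>v\<in>verts (atom_graph \<Sigma> \<phi>).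
                  (\<forall>b\<in>set as \<union> set bs. connected_by (atom_graph \<Sigma> \<phi>) b b InitPlus v) \<and>
                  (\<forall>c\<in>set as \<union> set cs. connected_by (atom_graph \<Sigma> \<phi>) c c InitMinus v))))"
proof (intro conjI allI impI iffI)
  fix as bs
  assume \<phi>: "\<phi> = Inc as bs" and "entails TYPE('m) \<Sigma> \<phi>"
  then show "\<exists>w\<in>verts (atom_graph \<Sigma> \<phi>). \<forall>i<length as.
      connected_by (atom_graph \<Sigma> \<phi>) (as ! i) (bs ! i) Init w"
    using connected_if_entails_Inc[of \<Sigma> as bs] assms by simp
next
  fix as bs
  assume \<phi>: "\<phi> = Inc as bs" and "\<exists>w\<in>verts (atom_graph \<Sigma> \<phi>). \<forall>i<length as.
      connected_by (atom_graph \<Sigma> \<phi>) (as ! i) (bs ! i) Init w"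
  then obtain w where "w \<in> verts (atom_graph \<Sigma> (Inc as bs))"
    "\<forall>i<length as. connected_by (atom_graph \<Sigma> (Inc as bs)) (as ! i) (bs ! i) Init w"
    by blast
  moreover have "length as = length bs" "\<forall>\<sigma>\<in>\<Sigma>. wf_atom \<sigma>" using assms(2) \<phi> by auto
  ultimately show "entails TYPE('m) \<Sigma> \<phi>"
    unfolding entails_def \<phi> by (blast intro: satisfies_Inc_if_connected)
next
  fix bs as cs
  assume \<phi>: "\<phi> = Ind bs as cs" and "entails TYPE('m) \<Sigma> \<phi>"
  then show "\<exists>v\<in>verts (atom_graph \<Sigma> \<phi>).
      (\<forall>b\<in>set as \<union> set bs. connected_by (atom_graph \<Sigma> \<phi>) b b InitPlus v) \<and>
      (\<forall>c\<in>set as \<union> set cs. connected_by (atom_graph \<Sigma> \<phi>) c c InitMinus v)"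
    using connected_if_entails_Ind[of \<Sigma> bs as cs] assms by simp
next
  fix bs as cs
  assume \<phi>: "\<phi> = Ind bs as cs" and "\<exists>v\<in>verts (atom_graph \<Sigma> \<phi>).
      (\<forall>b\<in>set as \<union> set bs. connected_by (atom_graph \<Sigma> \<phi>) b b InitPlus v) \<and>
      (\<forall>c\<in>set as \<union> set cs. connected_by (atom_graph \<Sigma> \<phi>) c c InitMinus v)"
  then obtain v where v: "v \<in> verts (atom_graph \<Sigma> (Ind bs as cs))"
    "\<forall>b\<in>set as \<union> set bs. connected_by (atom_graph \<Sigma> (Ind bs as cs)) b b InitPlus v"
    "\<forall>c\<in>set as \<union> set cs. connected_by (atom_graph \<Sigma> (Ind bs as cs)) c c InitMinus v"
    by blast
  have "\<forall>\<sigma>\<in>\<Sigma>. wf_atom \<sigma>" using assms(2) by simp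
  then show "entails TYPE('m) \<Sigma> \<phi>"
    unfolding entails_def \<phi> using satisfies_Ind_if_connected[OF _ _ v] by blast
qed

end
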